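(* In the matching market with preference uncertainty described in the context, let $\pi$ be a signal profile and let $b,b'\in MC(\pi)$. Then $D^\pi_p(b)=D^\pi_p(b')$ for all $p\in P$. Moreover, if $D^\pi_p(b)=D^\pi_p(b')<M_p$ for some program $p$, then $p$ receives the same random allocation of students under $b$ and $b'$, i.e. for every student $s_k$ the probability that $s_k$ is matched to $p$ is the same under $b$ and $b'$: $q^\pi_{k,p}(b)=q^\pi_{k,p}(b')$ for all $1\le k\le t$.
   Context: Market. $S=\{s_1,\dots,s_t\}$ is a finite set of students and $P=\{p_1,\dots,p_n\}$ a finite set of programs. Each program $p$ has a strict priority (strict linear order) $\mathcal{R}_p$ over $S$ ($s\,\mathcal{R}_p\,s'$ means $s$ has higher priority than $s'$) and a capacity $M_p$, a positive integer. $\Omega$ is a finite set of states; in each state each student has a strict preference over $P$. $\psi\in\Delta(\Omega)$ is a common prior. Student $s_k$ has utility $u_k:P\times\Omega\to\mathbb{R}$ with $u_k(p,\omega)>u_k(p',\omega)$ iff $s_k$ strictly prefers $p$ to $p'$ in state $\omega$. Signals. A signal $\pi_k$ of $s_k$ consists of a finite set $I_k$ of realizations and distributions $\pi_k(\cdot|\omega)\in\Delta(I_k)$, $\omega\in\Omega$. Realization $i_k$ induces the Bayesian posterior $\mu_k^{i_k}(\omega)=\pi_k(i_k|\omega)\psi(\omega)/\sum_{\omega'}\pi_k(i_k|\omega')\psi(\omega')$. A signal profile is $\pi=(\pi_k)_{1\le k\le t}$. Standing assumption: no two distinct programs give a student the same expected payoff under the prior or under any posterior. Cutoffs. The rank of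 $s_k$ at $p$ is $r_p(s_k)=1+|\{s\in S: s\,\mathcal{R}_p\,s_k\}|$. A deterministic cutoff is $\bar b\in\bar B=\mathbb{N}^n$ (with $0\in\mathbb{N}$), and $C(s_k,\bar b)=\{p\in P: r_p(s_k)\le\bar b_p\}$ is the induced choice set. For $b\in\mathbb{R}^n_{\ge0}$ let $\phi^b_p(m)=\max\{0,1-|b_p-m|\}$ for $m\in\mathbb{N}$ and $\phi^b(\bar b)=\prod_{p\in P}\phi^b_p(\bar b_p)$, a probability distribution on $\bar B$. Ex-ante cutoffs (for market clearing) are elements of $[0,t]^n$. Decision rule. For nonempty $C\subseteq P$, $\sigma_k(C,i_k)=\arg\max_{p\in C}\sum_{\omega}\mu_k^{i_k}(\omega)u_k(p,\omega)$. A student with empty choice set is unmatched (chooses no program). Demand and market clearing. The probability that $s_k$ is matched to $p$ is $q^\pi_{k,p}(b)=\sum_{\bar b,i_k,\omega}\phi^b(\bar b)\,\psi(\omega)\,\pi_k(i_k|\omega)\,\mathbf{1}\{\sigma_k(C(s_k,\bar b),i_k)=p\}$, where the indicator is $0$ if $C(s_k,\bar b)=\emptyset$, and the demand for $p$ is $D^\pi_p(b)=\sum_{k=1}^t q^\pi_{k,p}(b)$. An ex-ante cutoff $b\in[0,t]^n$ clears the market under $\pi$ if for all $p\in P$, $D^\pi_p(b)\le M_p$, with equality whenever $b_p<t$. $MC(\pi)$ is the set of all such $b$. *)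

theory Defs
  imports "HOL-Probability.Probability"
begin

text \<open>
  Students, programs and states are the elements of finite types; type \<open>'i\<close> is a common universe
  for the students' (finite) realization sets. \<open>(s, s') \<in> R p\<close> means that \<open>s\<close> has higher priority
  than \<open>s'\<close> at \<open>p\<close>, and \<open>(p, p') \<in> pref k w\<close> that \<open>k\<close> strictly prefers \<open>p\<close> to \<open>p'\<close> in state \<open>w\<close>.
\<close>

locale matching_market =
  fixes R :: "'p::finite \<Rightarrow> ('s::finite \<times> 's) set"
    and M :: "'p \<Rightarrow> nat"
    and pref :: "'s \<Rightarrow> 'w::finite \<Rightarrow> ('p \<times> 'p) set"
    and \<psi> :: "'w pmf"
    and u :: "'s \<Rightarrow> 'p \<Rightarrow> 'w \<Rightarrow> real"
  assumes priority: "strict_linear_order (R p)"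
    and capacity: "0 < M p"
    and preference: "strict_linear_order (pref k w)"
    and utility: "u k p w > u k p' w \<longleftrightarrow> (p, p') \<in> pref k w"
    and prior_generic:
      "p \<noteq> p' \<Longrightarrow> (\<Sum>w\<in>UNIV. pmf \<psi> w * u k p w) \<noteq> (\<Sum>w\<in>UNIV. pmf \<psi> w * u k p' w)"

definition posterior ::
  "'w::finite pmf \<Rightarrow> ('s \<Rightarrow> 'w \<Rightarrow> 'i pmf) \<Rightarrow> 's \<Rightarrow> 'i \<Rightarrow> 'w \<Rightarrow> real" where
  "posterior \<psi> \<pi> k i w =
     pmf (\<pi> k w) i * pmf \<psi> w / (\<Sum>w'\<in>UNIV. pmf (\<pi> k w') i * pmf \<psi> w')"

definition expected_payoff ::
  "('s \<Rightarrow> 'p \<Rightarrow> 'w::finite \<Rightarrow> real) \<Rightarrow> 'w pmf \<Rightarrow> ('s \<Rightarrow> 'w \<Rightarrow> 'i pmf) \<Rightarrow> 's \<Rightarrow> 'i \<Rightarrow> 'p \<Rightarrow> real" where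
  "expected_payoff u \<psi> \<pi> k i p = (\<Sum>w\<in>UNIV. posterior \<psi> \<pi> k i w * u k p w)"

text \<open>
  Genericity is imposed only at realizations that occur with positive probability; at the others
  the posterior is not defined by Bayes' rule.
\<close>

locale market_with_signals = matching_market R M pref \<psi> u
  for R :: "'p::finite \<Rightarrow> ('s::finite \<times> 's) set"
    and M :: "'p \<Rightarrow> nat"
    and pref :: "'s \<Rightarrow> 'w::finite \<Rightarrow> ('p \<times> 'p) set"
    and \<psi> :: "'w pmf"
    and u :: "'s \<Rightarrow> 'p \<Rightarrow> 'w \<Rightarrow> real" +
  fixes I :: "'s \<Rightarrow> 'i set"
    and \<pi> :: "'s \<Rightarrow> 'w \<Rightarrow> 'i pmf"
  assumes finite_realizations: "finite (I k)"
    and signal_support: "set_pmf (\<pi> k w) \<subseteq> I k"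
    and posterior_generic:
      "\<lbrakk>i \<in> I k; 0 < (\<Sum>w\<in>UNIV. pmf (\<pi> k w) i * pmf \<psi> w); p \<noteq> p'\<rbrakk>
        \<Longrightarrow> expected_payoff u \<psi> \<pi> k i p \<noteq> expected_payoff u \<psi> \<pi> k i p'"

definition priority_rank :: "('p \<Rightarrow> ('s \<times> 's) set) \<Rightarrow> 'p \<Rightarrow> 's \<Rightarrow> nat" where
  "priority_rank R p k = 1 + card {s. (s, k) \<in> R p}"

definition choice_set :: "('p \<Rightarrow> ('s \<times> 's) set) \<Rightarrow> 's \<Rightarrow> ('p \<Rightarrow> nat) \<Rightarrow> 'p set" where
  "choice_set R k c = {p. priority_rank R p k \<le> c p}"

definition rounding_weight :: "('p \<Rightarrow> real) \<Rightarrow> 'p \<Rightarrow> nat \<Rightarrow> real" where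
  "rounding_weight b p m = max 0 (1 - \<bar>b p - real m\<bar>)"

definition cutoff_prob :: "('p::finite \<Rightarrow> real) \<Rightarrow> ('p \<Rightarrow> nat) \<Rightarrow> real" where
  "cutoff_prob b c = (\<Prod>p\<in>UNIV. rounding_weight b p (c p))"

text \<open>
  At a positive-probability realization the maximizer over a nonempty \<open>C\<close> is unique by
  genericity. Zero-probability realizations have weight 0 in \<open>match_prob\<close>, and empty choice sets
  are excluded there explicitly, so the arbitrary value of the library's \<open>arg_max_on\<close> in these
  cases is irrelevant.
\<close>

definition decision ::
  "('s \<Rightarrow> 'p \<Rightarrow> 'w::finite \<Rightarrow> real) \<Rightarrow> 'w pmf \<Rightarrow> ('s \<Rightarrow> 'w \<Rightarrow> 'i pmf) \<Rightarrow> 's \<Rightarrow> 'p set \<Rightarrow> 'i \<Rightarrow> 'p" where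
  "decision u \<psi> \<pi> k C i = arg_max_on (expected_payoff u \<psi> \<pi> k i) C"

definition match_prob ::
  "('p::finite \<Rightarrow> ('s \<times> 's) set) \<Rightarrow> ('s \<Rightarrow> 'p \<Rightarrow> 'w::finite \<Rightarrow> real) \<Rightarrow> 'w pmf
    \<Rightarrow> ('s \<Rightarrow> 'i set) \<Rightarrow> ('s \<Rightarrow> 'w \<Rightarrow> 'i pmf) \<Rightarrow> 's \<Rightarrow> 'p \<Rightarrow> ('p \<Rightarrow> real) \<Rightarrow> real" where
  "match_prob R u \<psi> I \<pi> k p b =
     (\<Sum>\<^sub>\<infinity>c. \<Sum>i\<in>I k. \<Sum>w\<in>UNIV.
        cutoff_prob b c * pmf \<psi> w * pmf (\<pi> k w) i *
        of_bool (choice_set R k c \<noteq> {} \<and> decision u \<psi> \<pi> k (choice_set R k c) i = p))"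

definition demand ::
  "('p::finite \<Rightarrow> ('s::finite \<times> 's) set) \<Rightarrow> ('s \<Rightarrow> 'p \<Rightarrow> 'w::finite \<Rightarrow> real) \<Rightarrow> 'w pmf
    \<Rightarrow> ('s \<Rightarrow> 'i set) \<Rightarrow> ('s \<Rightarrow> 'w \<Rightarrow> 'i pmf) \<Rightarrow> 'p \<Rightarrow> ('p \<Rightarrow> real) \<Rightarrow> real" where
  "demand R u \<psi> I \<pi> p b = (\<Sum>k\<in>UNIV. match_prob R u \<psi> I \<pi> k p b)"

definition market_clearing ::
  "('p::finite \<Rightarrow> ('s::finite \<times> 's) set) \<Rightarrow> ('p \<Rightarrow> nat) \<Rightarrow> ('s \<Rightarrow> 'p \<Rightarrow> 'w::finite \<Rightarrow> real) \<Rightarrow> 'w pmf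
    \<Rightarrow> ('s \<Rightarrow> 'i set) \<Rightarrow> ('s \<Rightarrow> 'w \<Rightarrow> 'i pmf) \<Rightarrow> ('p \<Rightarrow> real) set" where
  "market_clearing R M u \<psi> I \<pi> =
     {b. \<forall>p. 0 \<le> b p \<and> b p \<le> real CARD('s) \<and>
             demand R u \<psi> I \<pi> p b \<le> real (M p) \<and>
             (b p < real CARD('s) \<longrightarrow> demand R u \<psi> I \<pi> p b = real (M p))}"

text \<open>
  Only finitely many deterministic cutoffs carry weight, so the infinite sum in \<open>match_prob\<close> is
  a finite one.
\<close>

lemma finite_cutoff_support:
  fixes b :: "'p::finite \<Rightarrow> real"
  shows "finite {c. cutoff_prob b c \<noteq> 0}"
proof (rule finite_subset)
  show "{c. cutoff_prob b c \<noteq> 0} \<subseteq> PiE UNIV (\<lambda>p. {..nat \<lceil>b p + 1\<rceil>})"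
  proof
    fix c assume "c \<in> {c. cutoff_prob b c \<noteq> 0}"
    then have "rounding_weight b p (c p) \<noteq> 0" for p
      by (auto simp: cutoff_prob_def)
    then have "real (c p) < b p + 1" for p
      unfolding rounding_weight_def max_def by (smt (verit))
    then have "c p \<le> nat \<lceil>b p + 1\<rceil>" for p
      by (smt (verit) real_nat_ceiling_ge of_nat_le_iff)
    then show "c \<in> PiE UNIV (\<lambda>p. {..nat \<lceil>b p + 1\<rceil>})"
      by auto
  qed
  show "finite (PiE UNIV (\<lambda>p. {..nat \<lceil>b p + 1\<rceil>}))"
    by (rule finite_PiE) auto
qed

end

theory Submission
  imports Defs
begin

text \<open>
  Rounding is independent across programs, so, given a realization, a student is matched to \<open>p\<close>
  with probability \<open>(1 - t p) * \<Prod>q. t q\<close>, where \<open>t q\<close> is the probability of missing the cutoff of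
  \<open>q\<close> and \<open>q\<close> ranges over the programs preferred to \<open>p\<close>. Hence raising the cutoffs of programs
  other than \<open>p\<close> lowers the demand for \<open>p\<close>, while raising any cutoffs raises total demand. For
  clearing \<open>b\<close>, \<open>b'\<close> and their pointwise maximum \<open>d\<close>, the demand at \<open>d\<close> is at most that at \<open>b\<close>
  for every program: if \<open>b' p \<le> b p\<close> by substitutability, and if \<open>b p < b' p\<close> because \<open>p\<close> fills its
  capacity at \<open>b\<close>. As total demand at \<open>d\<close> is at least that at \<open>b\<close>, the demands coincide. A
  program with spare capacity has the maximal cutoff in \<open>b\<close>, \<open>b'\<close> and \<open>d\<close>, so its match
  probabilities at \<open>d\<close> are bounded student by student by those at \<open>b\<close>, with equal sums.
\<close>

section \<open>Independent rounding of cutoffs and match probabilities\<close>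

lemma rounding_weight_summable: "rounding_weight b p summable_on A"
proof (rule finite_nonzero_values_imp_summable_on)
  have "m \<le> nat \<lceil>b p + 1\<rceil>" if "rounding_weight b p m \<noteq> 0" for m
  proof -
    have "real m < b p + 1"
      using that unfolding rounding_weight_def max_def by (smt (verit))
    then show ?thesis
      by (smt (verit) real_nat_ceiling_ge of_nat_le_iff)
  qed
  then have "{m \<in> A. rounding_weight b p m \<noteq> 0} \<subseteq> {..nat \<lceil>b p + 1\<rceil>}"
    by auto
  then show "finite {m \<in> A. rounding_weight b p m \<noteq> 0}"
    by (rule finite_subset) simp
qed

lemma cutoff_prob_summable: "cutoff_prob b summable_on A"
  by (rule finite_nonzero_values_imp_summable_on,
      rule finite_subset[OF _ finite_cutoff_support[of b]]) auto

text \<open>The weight of \<open>n\<close> is the increment of the clamped right-hand side from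
  \<open>n\<close> to \<open>n + 1\<close>. Since \<open>b p\<close> is nonnegative, the clamp is 0
  at 0, as the empty sum requires.\<close>

lemma rounding_weight_lessThan:
  assumes "0 \<le> b p"
  shows "(\<Sum>m<n. rounding_weight b p m) = max 0 (min 1 (real n - b p))"
proof (induction n)
  case 0
  then show ?case using assms by simp
next
  case (Suc n)
  then show ?case by (simp add: rounding_weight_def)
qed

lemma infsum_rounding_weight_UNIV:
  assumes "0 \<le> b p"
  shows "infsum (rounding_weight b p) UNIV = 1"
proof -
  \<comment> \<open>All weights from \<open>b p + 1\<close> on vanish, so the sum below
    \<open>n\<close> already has full mass.\<close>
  obtain n where n: "b p + 1 \<le> real n" using real_arch_simple by blast
  have "infsum (rounding_weight b p) UNIV = infsum (rounding_weight b p) {..<n}"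
    by (rule infsum_cong_neutral) (use n in \<open>auto simp: rounding_weight_def\<close>)
  also have "\<dots> = 1"
    using n assms by (simp add: rounding_weight_lessThan)
  finally show ?thesis .
qed

lemma infsum_rounding_weight_atLeast:
  assumes "0 \<le> b p"
  shows "infsum (rounding_weight b p) {n..} = 1 - max 0 (min 1 (real n - b p))"
proof -
  have "infsum (rounding_weight b p) ({..<n} \<union> {n..}) =
      infsum (rounding_weight b p) {..<n} + infsum (rounding_weight b p) {n..}"
    by (rule infsum_Un_disjoint) (auto simp: rounding_weight_summable)
  moreover have "{..<n} \<union> {n..} = UNIV" by auto
  ultimately show ?thesis
    using assms by (simp add: infsum_rounding_weight_UNIV rounding_weight_lessThan)
qed

text \<open>Independence across programs makes the mass of a box factor. As the weights are
  nonnegative, their summability is the absolute summability that the product rule asks for.\<close>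

lemma infsum_cutoff_prob_PiE:
  "infsum (cutoff_prob b) (PiE UNIV A) = (\<Prod>p\<in>UNIV. infsum (rounding_weight b p) (A p))"
proof -
  have "(\<lambda>m. norm (rounding_weight b p m)) summable_on A p" for p
  proof -
    have "norm (rounding_weight b p m) = rounding_weight b p m" for m
      by (simp add: rounding_weight_def)
    then show ?thesis by (simp add: rounding_weight_summable)
  qed
  then show ?thesis
    unfolding cutoff_prob_def by (intro infsum_prod_PiE_abs) auto
qed

text \<open>For nonnegative \<open>b p\<close>, \<open>rounding_weight_lessThan\<close> identifies
  this with the probability that the rounded cutoff falls short of the rank. The closed form makes
  monotonicity in \<open>b p\<close> immediate.\<close>

definition rejection_prob :: "('p \<Rightarrow> ('s \<times> 's) set) \<Rightarrow> 's \<Rightarrow> ('p \<Rightarrow> real) \<Rightarrow> 'p \<Rightarrow> real" where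
  "rejection_prob R k b p = max 0 (min 1 (real (priority_rank R p k) - b p))"

lemma rejection_prob_bounds: "0 \<le> rejection_prob R k b p" "rejection_prob R k b p \<le> 1"
  by (simp_all add: rejection_prob_def)

lemma rejection_prob_antimono:
  "b p \<le> b' p \<Longrightarrow> rejection_prob R k b' p \<le> rejection_prob R k b p"
  by (auto simp: rejection_prob_def)

text \<open>Rounding is independent of states and signals, so \<open>match_prob\<close> is a mixture
  of these with weights that do not depend on \<open>b\<close>.\<close>

definition choice_prob ::
  "('p::finite \<Rightarrow> ('s \<times> 's) set) \<Rightarrow> ('s \<Rightarrow> 'p \<Rightarrow> 'w::finite \<Rightarrow> real) \<Rightarrow> 'w pmf
    \<Rightarrow> ('s \<Rightarrow> 'w \<Rightarrow> 'i pmf) \<Rightarrow> 's \<Rightarrow> 'i \<Rightarrow> 'p \<Rightarrow> ('p \<Rightarrow> real) \<Rightarrow> real" where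
  "choice_prob R u \<psi> \<pi> k i p b =
     infsum (cutoff_prob b)
       {c. choice_set R k c \<noteq> {} \<and> decision u \<psi> \<pi> k (choice_set R k c) i = p}"

lemma match_prob_eq:
  "match_prob R u \<psi> I \<pi> k p b =
    (\<Sum>i\<in>I k. \<Sum>w\<in>UNIV. pmf \<psi> w * pmf (\<pi> k w) i * choice_prob R u \<psi> \<pi> k i p b)"
proof -
  let ?E = "\<lambda>i. {c. choice_set R k c \<noteq> {} \<and> decision u \<psi> \<pi> k (choice_set R k c) i = p}"
  let ?f = "\<lambda>i w c. cutoff_prob b c * pmf \<psi> w * pmf (\<pi> k w) i *
        of_bool (choice_set R k c \<noteq> {} \<and> decision u \<psi> \<pi> k (choice_set R k c) i = p)"
  let ?F = "{c. cutoff_prob b c \<noteq> 0}"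
  \<comment> \<open>Passing to finite sums allows the order of summation to be exchanged
    freely.\<close>
  have finite_support: "infsum g UNIV = sum g ?F"
    if "\<And>c. cutoff_prob b c = 0 \<Longrightarrow> g c = 0" for g :: "_ \<Rightarrow> real"
  proof -
    have "infsum g UNIV = infsum g ?F"
      by (rule infsum_cong_neutral) (use that in auto)
    then show ?thesis by (simp add: finite_cutoff_support)
  qed
  have "infsum (?f i w) UNIV = pmf \<psi> w * pmf (\<pi> k w) i * choice_prob R u \<psi> \<pi> k i p b" for i w
  proof -
    have "infsum (?f i w) UNIV =
        (\<Sum>\<^sub>\<infinity>c\<in>?E i. (pmf \<psi> w * pmf (\<pi> k w) i) * cutoff_prob b c)"
      by (rule infsum_cong_neutral) auto
    then show ?thesis
      by (simp only: infsum_cmult_right' choice_prob_def)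
  qed
  then have inner: "sum (?f i w) ?F = pmf \<psi> w * pmf (\<pi> k w) i * choice_prob R u \<psi> \<pi> k i p b" for i w
    by (subst finite_support[symmetric]) auto
  have "match_prob R u \<psi> I \<pi> k p b = (\<Sum>c\<in>?F. \<Sum>i\<in>I k. \<Sum>w\<in>UNIV. ?f i w c)"
    unfolding match_prob_def by (rule finite_support) auto
  also have "\<dots> = (\<Sum>i\<in>I k. \<Sum>c\<in>?F. \<Sum>w\<in>UNIV. ?f i w c)"
    by (rule sum.swap)
  also have "\<dots> = (\<Sum>i\<in>I k. \<Sum>w\<in>UNIV. sum (?f i w) ?F)"
    by (intro sum.cong refl sum.swap)
  finally show ?thesis unfolding inner .
qed

text \<open>Whatever \<open>decision\<close> returns, a student chooses exactly one program unless
  every rounded cutoff is below the rank. Hence realizations of probability zero are covered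
  too.\<close>

lemma sum_choice_prob:
  fixes b :: "'p::finite \<Rightarrow> real"
  assumes "\<And>p. 0 \<le> b p"
  shows "(\<Sum>p\<in>UNIV. choice_prob R u \<psi> \<pi> k i p b) = 1 - (\<Prod>p\<in>UNIV. rejection_prob R k b p)"
proof -
  let ?E = "\<lambda>p. {c. choice_set R k c \<noteq> {} \<and> decision u \<psi> \<pi> k (choice_set R k c) i = p}"
  let ?N = "{c. choice_set R k c = {}}"
  have "(\<Sum>p\<in>UNIV. choice_prob R u \<psi> \<pi> k i p b) = infsum (cutoff_prob b) (\<Union>p. ?E p)"
    unfolding choice_prob_def
    by (rule sum_infsum) (auto simp: cutoff_prob_summable)
  moreover have "infsum (cutoff_prob b) ((\<Union>p. ?E p) \<union> ?N) =
      infsum (cutoff_prob b) (\<Union>p. ?E p) + infsum (cutoff_prob b) ?N"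
    by (rule infsum_Un_disjoint) (auto simp: cutoff_prob_summable)
  moreover have "(\<Union>p. ?E p) \<union> ?N = PiE UNIV (\<lambda>_. UNIV)" by auto
  moreover have "infsum (cutoff_prob b) (PiE UNIV (\<lambda>_. UNIV)) = 1"
    by (simp add: infsum_cutoff_prob_PiE infsum_rounding_weight_UNIV assms del: PiE_UNIV)
  moreover have "?N = PiE UNIV (\<lambda>p. {..<priority_rank R p k})"
    by (auto simp: choice_set_def not_le)
  ultimately show ?thesis
    by (simp add: infsum_cutoff_prob_PiE rounding_weight_lessThan assms rejection_prob_def)
qed

section \<open>Monotonicity of total demand\<close>

lemma sum_choice_prob_mono:
  assumes "\<And>p. 0 \<le> b p" "\<And>p. b p \<le> b' p"
  shows "(\<Sum>p\<in>UNIV. choice_prob R u \<psi> \<pi> k i p b) \<le> (\<Sum>p\<in>UNIV. choice_prob R u \<psi> \<pi> k i p b')"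
proof -
  have "0 \<le> b' p" for p using assms[of p] by simp
  moreover have "(\<Prod>p\<in>UNIV. rejection_prob R k b' p) \<le> (\<Prod>p\<in>UNIV. rejection_prob R k b p)"
    by (intro prod_mono) (auto simp: rejection_prob_bounds rejection_prob_antimono assms)
  ultimately show ?thesis by (simp add: sum_choice_prob assms)
qed

lemma sum_match_prob_mono:
  assumes "\<And>p. 0 \<le> b p" "\<And>p. b p \<le> b' p"
  shows "(\<Sum>p\<in>UNIV. match_prob R u \<psi> I \<pi> k p b) \<le> (\<Sum>p\<in>UNIV. match_prob R u \<psi> I \<pi> k p b')"
proof -
  have swap: "(\<Sum>p\<in>UNIV. match_prob R u \<psi> I \<pi> k p d) =
      (\<Sum>i\<in>I k. \<Sum>w\<in>UNIV. pmf \<psi> w * pmf (\<pi> k w) i * (\<Sum>p\<in>UNIV. choice_prob R u \<psi> \<pi> k i p d))" for d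
    unfolding match_prob_eq sum_distrib_left
    by (subst sum.swap) (intro sum.cong refl sum.swap)
  show ?thesis
    unfolding swap by (intro sum_mono mult_left_mono sum_choice_prob_mono assms) auto
qed

lemma sum_demand_mono:
  assumes "\<And>p. 0 \<le> b p" "\<And>p. b p \<le> b' p"
  shows "(\<Sum>p\<in>UNIV. demand R u \<psi> I \<pi> p b) \<le> (\<Sum>p\<in>UNIV. demand R u \<psi> I \<pi> p b')"
proof -
  have swap: "(\<Sum>p\<in>UNIV. demand R u \<psi> I \<pi> p d) =
      (\<Sum>k\<in>UNIV. \<Sum>p\<in>UNIV. match_prob R u \<psi> I \<pi> k p d)" for d
    unfolding demand_def by (rule sum.swap)
  show ?thesis
    unfolding swap by (intro sum_mono sum_match_prob_mono assms)
qed

section \<open>Optimal choices and substitutability\<close>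

lemma arg_max_on_eq_iff:
  fixes f :: "'a \<Rightarrow> 'b::linorder"
  assumes "finite C" "inj f"
  shows "C \<noteq> {} \<and> arg_max_on f C = p \<longleftrightarrow> p \<in> C \<and> (\<forall>q. f p < f q \<longrightarrow> q \<notin> C)"
proof -
  \<comment> \<open>Injectivity makes the maximizer unique, which pins down the value of
    \<open>arg_max_on\<close>.\<close>
  have arg_max: "arg_max_on f C = q" if "q \<in> C" "\<And>x. x \<in> C \<Longrightarrow> f x \<le> f q" for q
    using arg_max_equality[of "\<lambda>x. x \<in> C" q f] that injD[OF \<open>inj f\<close>]
    unfolding arg_max_on_def by blast
  show ?thesis
  proof
    assume *: "C \<noteq> {} \<and> arg_max_on f C = p"
    then have "Max (f ` C) \<in> f ` C"
      using \<open>finite C\<close> by (intro Max_in) auto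
    then obtain q where "q \<in> C" "f q = Max (f ` C)" by auto
    then have "q \<in> C" "\<And>x. x \<in> C \<Longrightarrow> f x \<le> f q"
      using \<open>finite C\<close> by auto
    with * arg_max[of q] show "p \<in> C \<and> (\<forall>q. f p < f q \<longrightarrow> q \<notin> C)"
      by (auto simp: not_less[symmetric])
  next
    assume "p \<in> C \<and> (\<forall>q. f p < f q \<longrightarrow> q \<notin> C)"
    then show "C \<noteq> {} \<and> arg_max_on f C = p"
      using arg_max[of p] by (auto simp: not_less[symmetric])
  qed
qed

context market_with_signals
begin

text \<open>Genericity makes the payoffs injective, so choosing \<open>p\<close> means reaching its
  cutoff and missing that of every better program. This imposes one condition per coordinate, so the
  event is a box.\<close>

lemma choice_prob_eq:
  assumes "i \<in> I k" "0 < (\<Sum>w\<in>UNIV. pmf (\<pi> k w) i * pmf \<psi> w)" "\<And>p. 0 \<le> b p"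
  shows "choice_prob R u \<psi> \<pi> k i p b =
    (\<Prod>q\<in>UNIV. if q = p then 1 - rejection_prob R k b q
      else if expected_payoff u \<psi> \<pi> k i p < expected_payoff u \<psi> \<pi> k i q then rejection_prob R k b q
      else 1)"
proof -
  let ?f = "expected_payoff u \<psi> \<pi> k i"
  let ?A = "\<lambda>q. if q = p then {priority_rank R q k..}
    else if ?f p < ?f q then {..<priority_rank R q k} else UNIV"
  have "inj ?f"
    using posterior_generic[OF assms(1,2)] by (intro injI) blast
  then have "{c. choice_set R k c \<noteq> {} \<and> decision u \<psi> \<pi> k (choice_set R k c) i = p} =
      {c. p \<in> choice_set R k c \<and> (\<forall>q. ?f p < ?f q \<longrightarrow> q \<notin> choice_set R k c)}"
    unfolding decision_def by (simp add: arg_max_on_eq_iff)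
  also have "\<dots> = PiE UNIV ?A"
    by (auto simp: choice_set_def PiE_UNIV_domain Pi_def not_le split: if_splits)
  finally have "choice_prob R u \<psi> \<pi> k i p b = infsum (cutoff_prob b) (PiE UNIV ?A)"
    unfolding choice_prob_def by (rule arg_cong)
  also have "\<dots> = (\<Prod>q\<in>UNIV. infsum (rounding_weight b q) (?A q))"
    by (rule infsum_cutoff_prob_PiE)
  finally show ?thesis
    by (auto intro!: prod.cong simp: assms(3) infsum_rounding_weight_UNIV
        infsum_rounding_weight_atLeast rounding_weight_lessThan rejection_prob_def)
qed

lemma match_prob_antimono:
  assumes nonneg: "\<And>q. 0 \<le> b q" and le: "\<And>q. b q \<le> b' q" and eq: "b p = b' p"
  shows "match_prob R u \<psi> I \<pi> k p b' \<le> match_prob R u \<psi> I \<pi> k p b"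
  unfolding match_prob_eq
proof (intro sum_mono)
  fix i w assume i: "i \<in> I k"
  show "pmf \<psi> w * pmf (\<pi> k w) i * choice_prob R u \<psi> \<pi> k i p b'
      \<le> pmf \<psi> w * pmf (\<pi> k w) i * choice_prob R u \<psi> \<pi> k i p b"
  \<comment> \<open>A term of weight zero is trivial; a positive weight gives the realization the
    positive probability needed for \<open>choice_prob_eq\<close>.\<close>
  proof (cases "pmf (\<pi> k w) i * pmf \<psi> w = 0")
    case True
    then show ?thesis by auto
  next
    case False
    then have "0 < pmf (\<pi> k w) i * pmf \<psi> w" by (simp add: less_le)
    then have pos: "0 < (\<Sum>w\<in>UNIV. pmf (\<pi> k w) i * pmf \<psi> w)"
      by (intro sum_pos2[of UNIV w]) auto
    have "0 \<le> b' q" for q using nonneg[of q] le[of q] by simp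
    moreover have "rejection_prob R k b' p = rejection_prob R k b p"
      by (simp add: rejection_prob_def eq)
    \<comment> \<open>The factor of \<open>p\<close> is unchanged, and the rejection factors of
      better programs can only shrink.\<close>
    ultimately have "choice_prob R u \<psi> \<pi> k i p b' \<le> choice_prob R u \<psi> \<pi> k i p b"
      by (simp only: choice_prob_eq[OF i pos] nonneg)
        (intro prod_mono, auto simp: rejection_prob_bounds rejection_prob_antimono le)
    then show ?thesis by (intro mult_left_mono) auto
  qed
qed

lemma demand_antimono:
  assumes "\<And>q. 0 \<le> b q" "\<And>q. b q \<le> b' q" "b p = b' p"
  shows "demand R u \<psi> I \<pi> p b' \<le> demand R u \<psi> I \<pi> p b"
  unfolding demand_def by (intro sum_mono match_prob_antimono assms)

section \<open>Comparison of clearing cutoffs with their maximum\<close>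

lemma demand_max_eq:
  assumes b: "b \<in> market_clearing R M u \<psi> I \<pi>" and b': "b' \<in> market_clearing R M u \<psi> I \<pi>"
  shows "demand R u \<psi> I \<pi> p (\<lambda>q. max (b q) (b' q)) = demand R u \<psi> I \<pi> p b"
proof -
  let ?D = "demand R u \<psi> I \<pi>" and ?d = "\<lambda>q. max (b q) (b' q)"
  have nonneg: "0 \<le> b q" "0 \<le> b' q" for q
    using b b' by (auto simp: market_clearing_def)
  have le: "?D q ?d \<le> ?D q b" for q
  proof (cases "b' q \<le> b q")
    case True
    then show ?thesis by (intro demand_antimono nonneg) auto
  next
    case False
    have "b' q \<le> real CARD('s)"
      using b' by (auto simp: market_clearing_def)
    with False have "b q < real CARD('s)" by simp
    from False have "?D q ?d \<le> ?D q b'" by (intro demand_antimono nonneg) auto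
    also have "\<dots> \<le> real (M q)" using b' by (auto simp: market_clearing_def)
    also have "real (M q) = ?D q b"
      using b \<open>b q < real CARD('s)\<close> by (auto simp: market_clearing_def)
    finally show ?thesis .
  qed
  moreover have "(\<Sum>q\<in>UNIV. ?D q ?d) = (\<Sum>q\<in>UNIV. ?D q b)"
    by (intro antisym sum_mono le sum_demand_mono nonneg) auto
  \<comment> \<open>Termwise inequality with equal finite sums forces equality for each
    program.\<close>
  ultimately show ?thesis
    using sum_mono_inv[of "\<lambda>q. ?D q ?d" UNIV "\<lambda>q. ?D q b" p] by simp
qed

lemma match_prob_max_eq:
  assumes b: "b \<in> market_clearing R M u \<psi> I \<pi>" and b': "b' \<in> market_clearing R M u \<psi> I \<pi>"
    and "demand R u \<psi> I \<pi> p b < real (M p)"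
  shows "match_prob R u \<psi> I \<pi> k p (\<lambda>q. max (b q) (b' q)) = match_prob R u \<psi> I \<pi> k p b"
proof -
  let ?q = "match_prob R u \<psi> I \<pi>" and ?d = "\<lambda>q. max (b q) (b' q)"
  have nonneg: "0 \<le> b q" for q
    using b by (auto simp: market_clearing_def)
  \<comment> \<open>Spare capacity at \<open>b\<close> forces \<open>b p\<close> up to the bound
    \<open>CARD('s)\<close>, so the maximum leaves the cutoff of \<open>p\<close> unchanged.\<close>
  have "b' p \<le> b p"
  proof -
    have "\<not> b p < real CARD('s)" "b' p \<le> real CARD('s)"
      using assms by (auto simp: market_clearing_def)
    then show ?thesis by simp
  qed
  then have "?q k p ?d \<le> ?q k p b" for k
    by (intro match_prob_antimono nonneg) auto
  moreover have "(\<Sum>k\<in>UNIV. ?q k p ?d) = (\<Sum>k\<in>UNIV. ?q k p b)"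
    using demand_max_eq[OF b b'] by (simp add: demand_def)
  ultimately show ?thesis
    using sum_mono_inv[of "\<lambda>k. ?q k p ?d" UNIV "\<lambda>k. ?q k p b" k] by simp
qed

end

theorem proposition4p2:
  fixes R :: "'p::finite \<Rightarrow> ('s::finite \<times> 's) set"
    and M :: "'p \<Rightarrow> nat"
    and pref :: "'s \<Rightarrow> 'w::finite \<Rightarrow> ('p \<times> 'p) set"
    and \<psi> :: "'w pmf"
    and u :: "'s \<Rightarrow> 'p \<Rightarrow> 'w \<Rightarrow> real"
    and I :: "'s \<Rightarrow> 'i set"
    and \<pi> :: "'s \<Rightarrow> 'w \<Rightarrow> 'i pmf"
    and b b' :: "'p \<Rightarrow> real"
  assumes "market_with_signals R M pref \<psi> u I \<pi>"
    and "b \<in> market_clearing R M u \<psi> I \<pi>"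
    and "b' \<in> market_clearing R M u \<psi> I \<pi>"
  shows "(\<forall>p. demand R u \<psi> I \<pi> p b = demand R u \<psi> I \<pi> p b') \<and>
    (\<forall>p. demand R u \<psi> I \<pi> p b < real (M p) \<longrightarrow>
      (\<forall>k. match_prob R u \<psi> I \<pi> k p b = match_prob R u \<psi> I \<pi> k p b'))"
proof -
  interpret market_with_signals R M pref \<psi> u I \<pi> by fact
  \<comment> \<open>The comparison lemmas relate the maximum to their first cutoff only; by symmetry
    they apply in both orders.\<close>
  have swap: "(\<lambda>q. max (b q) (b' q)) = (\<lambda>q. max (b' q) (b q))"
    by (simp add: max.commute)
  have demand_eq: "demand R u \<psi> I \<pi> p b = demand R u \<psi> I \<pi> p b'" for p
    using demand_max_eq[OF assms(2,3), of p] demand_max_eq[OF assms(3,2), of p] swap by simp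
  moreover have "match_prob R u \<psi> I \<pi> k p b = match_prob R u \<psi> I \<pi> k p b'"
    if "demand R u \<psi> I \<pi> p b < real (M p)" for p k
    using match_prob_max_eq[OF assms(2,3), of p k] match_prob_max_eq[OF assms(3,2), of p k]
      that demand_eq[of p] swap by simp
  ultimately show ?thesis by simp
qed

end
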